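(* Let $r\in\mathbb{R}^m_{++}$, $c\in\mathbb{R}^n_{++}$ have equal total mass one, let $C\in\mathbb{R}^{m\times n}$, $\eta>0$, $K=\exp(-C/\eta)$ (entrywise), and let $\lambda\in[1,2)$. Let $(u^k,v^k,X^{k+1})_{k\ge 0}$ be the O-BDRS iterates with parameter $\lambda$, and define $\alpha^k=\bigodot_{t=0}^k(u^t)^{\odot\lambda}$ and $\beta^k=\bigodot_{t=0}^k(v^t)^{\odot\lambda}$, with $\alpha^{-1}=\mathbf{1}_m$ and $\beta^{-2}=\beta^{-1}=\mathbf{1}_n$. For $k\ge 0$ put $$K_k^{\mathrm O}:=K^{\odot(\lambda k+1)},\qquad \widetilde\beta^{k-1}:=\beta^{k-1}\odot\left(\beta^{k-1}\oslash\beta^{k-2}\right)^{\odot 1/\lambda}.$$ Then O-BDRS admits the following equations for every $k\ge0$: with $$\widehat\alpha^k:=r\oslash\left(K_k^{\mathrm O}\widetilde\beta^{k-1}\right),\qquad \widehat\beta^k:=c\oslash\left((K_k^{\mathrm O})^\top\widehat\alpha^k\right),$$ one has $$\alpha^k=(\alpha^{k-1})^{\odot(1-\lambda)}\odot(\widehat\alpha^k)^{\odot\lambda},\qquad \beta^k=(\beta^{k-1})^{\odot(1-\lambda)}\odot(\widehat\beta^k)^{\odot\lambda},$$ and the corresponding O-BDRS state is $$X^{k+1}=\operatorname{diag}(\alpha^k)\,K^{\odot\lambda(k+1)}\operatorname{diag}(\beta^k).$$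
   Context: Notation: $\odot$ and $\oslash$ are entrywise product and quotient, $M^{\odot p}$ denotes the entrywise (real) $p$-th power, fractions of vectors are entrywise quotients, $\exp$ of a matrix is entrywise, $\mathbf{1}$ denotes all-ones vectors or matrices. O-BDRS (overrelaxed Bregman Douglas--Rachford splitting for unregularized optimal transport) with parameter $\lambda$ is the iteration, initialized with $u^{-1}=\mathbf{1}_m$, $v^{-1}=\mathbf{1}_n$, $X^0=\mathbf{1}_{m\times n}$, and for $k=0,1,2,\dots$ $$u^k=\frac{r}{(X^k\odot K)v^{k-1}},\qquad v^k=\frac{c}{(X^k\odot K)^\top u^k},\qquad X^{k+1}=X^k\odot\Big(K\odot u^k(v^k)^\top\Big)^{\odot\lambda}.$$ *)

theory Defs
  imports "HOL-Analysis.Analysis"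
begin

text \<open>
  In the library, \<open>(*)\<close> on \<open>real ^ 'n\<close> and on \<open>real ^ 'n ^ 'm\<close> is the entrywise product and \<open>1\<close>
  is the all-ones vector or matrix (not the identity matrix, which is \<open>mat 1\<close>); both are used in
  this sense below. The matrix product is \<open>(**)\<close>.
\<close>

definition vec_divide :: "real ^ 'n \<Rightarrow> real ^ 'n \<Rightarrow> real ^ 'n"  (infixl "\<oslash>" 70)
  where "x \<oslash> y = (\<chi> i. x $ i / y $ i)"

definition vec_powr :: "real ^ 'n \<Rightarrow> real \<Rightarrow> real ^ 'n"
  where "vec_powr x p = (\<chi> i. x $ i powr p)"

definition mat_powr :: "real ^ 'n ^ 'm \<Rightarrow> real \<Rightarrow> real ^ 'n ^ 'm"
  where "mat_powr A p = (\<chi> i j. A $ i $ j powr p)"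

definition mat_exp_entrywise :: "real ^ 'n ^ 'm \<Rightarrow> real ^ 'n ^ 'm"
  where "mat_exp_entrywise A = (\<chi> i j. exp (A $ i $ j))"

definition outer_prod :: "real ^ 'm \<Rightarrow> real ^ 'n \<Rightarrow> real ^ 'n ^ 'm"
  where "outer_prod x y = (\<chi> i j. x $ i * y $ j)"

definition diag_mat :: "real ^ 'n \<Rightarrow> real ^ 'n ^ 'n"
  where "diag_mat x = (\<chi> i j. if i = j then x $ i else 0)"

text \<open>
  The sequences are indexed by \<open>int\<close> so that the initial values can sit at the index \<open>- 1\<close>;
  the predicate leaves \<open>u\<close> and \<open>v\<close> below \<open>- 1\<close> and \<open>X\<close> below \<open>0\<close> unconstrained.
\<close>

definition obdrs_iterates ::
    "real ^ 'm \<Rightarrow> real ^ 'n \<Rightarrow> real ^ 'n ^ 'm \<Rightarrow> real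
      \<Rightarrow> (int \<Rightarrow> real ^ 'm) \<Rightarrow> (int \<Rightarrow> real ^ 'n) \<Rightarrow> (int \<Rightarrow> real ^ 'n ^ 'm) \<Rightarrow> bool"
  where "obdrs_iterates r c K lam u v X \<longleftrightarrow>
    u (- 1) = 1 \<and> v (- 1) = 1 \<and> X 0 = 1 \<and>
    (\<forall>k\<ge>0.
      u k = r \<oslash> ((X k * K) *v v (k - 1)) \<and>
      v k = c \<oslash> (transpose (X k * K) *v u k) \<and>
      X (k + 1) = X k * mat_powr (K * outer_prod (u k) (v k)) lam)"

end

theory Submission
  imports Defs
begin

text \<open>
  By induction the state is the diagonal scaling
  \<open>X k = diag (\<alpha> (k - 1)) K\<^sup>\<lambda>\<^sup>k diag (\<beta> (k - 1))\<close>, so the kernel of step \<open>k\<close> is a diagonal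
  scaling of the entrywise power of \<open>K\<close> with exponent \<open>\<lambda>k + 1\<close>. Pulling the diagonal factors out of
  the matrix-vector products turns the updates into
  \<open>\<alpha> (k - 1) * u k = \<alpha>h\<close> and \<open>\<beta> (k - 1) * v k = \<beta>h\<close>; here \<open>v (k - 1)\<close>, which enters
  the first of them, is recovered from the quotient of consecutive \<open>\<beta>\<close>'s. The recursions follow by
  \<open>a u\<^sup>\<lambda> = a\<^sup>1\<^sup>-\<^sup>\<lambda> (a u)\<^sup>\<lambda>\<close>.
\<close>

text \<open>Strict positivity lets entrywise quotients cancel and the power \<open>1 / p\<close>
  undo the power \<open>p\<close>; the following lemmas carry it through the operations of the
  iteration.\<close>

definition vec_pos :: "real ^ 'n \<Rightarrow> bool"
  where "vec_pos x \<longleftrightarrow> (\<forall>i. 0 < x $ i)"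

definition mat_pos :: "real ^ 'n ^ 'm \<Rightarrow> bool"
  where "mat_pos A \<longleftrightarrow> (\<forall>i j. 0 < A $ i $ j)"

lemma vec_pos_one: "vec_pos 1"
  by (simp add: vec_pos_def)

lemma vec_pos_mult: "vec_pos x \<Longrightarrow> vec_pos y \<Longrightarrow> vec_pos (x * y)"
  by (simp add: vec_pos_def)

lemma vec_pos_divide: "vec_pos x \<Longrightarrow> vec_pos y \<Longrightarrow> vec_pos (x \<oslash> y)"
  by (simp add: vec_pos_def vec_divide_def)

lemma vec_pos_powr: "vec_pos x \<Longrightarrow> vec_pos (vec_powr x p)"
  by (auto simp: vec_pos_def vec_powr_def) (metis less_irrefl)

lemma vec_pos_matrix_vector_mult: "mat_pos A \<Longrightarrow> vec_pos x \<Longrightarrow> vec_pos (A *v x)"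
  by (simp add: vec_pos_def mat_pos_def matrix_vector_mult_def sum_pos)

lemma mat_pos_transpose: "mat_pos A \<Longrightarrow> mat_pos (transpose A)"
  by (simp add: mat_pos_def transpose_def)

lemma mat_pos_powr: "mat_pos A \<Longrightarrow> mat_pos (mat_powr A p)"
  by (auto simp: mat_pos_def mat_powr_def) (metis less_irrefl)

lemma mat_pos_exp_entrywise: "mat_pos (mat_exp_entrywise A)"
  by (simp add: mat_pos_def mat_exp_entrywise_def)

lemma vec_divide_mult_cancel: "vec_pos a \<Longrightarrow> a * (x \<oslash> (a * y)) = x \<oslash> y"
  by (auto simp: vec_eq_iff vec_divide_def vec_pos_def) (metis less_irrefl)

lemma vec_divide_mult_self: "vec_pos a \<Longrightarrow> (a * x) \<oslash> a = x"
  by (auto simp: vec_eq_iff vec_divide_def vec_pos_def) (metis less_irrefl)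

lemma vec_powr_powr_inverse: "vec_pos x \<Longrightarrow> p \<noteq> 0 \<Longrightarrow> vec_powr (vec_powr x p) (1 / p) = x"
  by (simp add: vec_eq_iff vec_powr_def vec_pos_def powr_powr less_imp_le)

lemma vec_powr_one: "vec_powr 1 p = 1"
  by (simp add: vec_eq_iff vec_powr_def)

lemma vec_divide_one: "x \<oslash> 1 = x"
  by (simp add: vec_eq_iff vec_divide_def)

text \<open>Each positive entry splits as \<open>a = a powr (1 - p) * a powr p\<close>, and the
  second factor merges with \<open>x powr p\<close>.\<close>

lemma vec_powr_relaxation:
  assumes "vec_pos a" "vec_pos x"
  shows "a * vec_powr x p = vec_powr a (1 - p) * vec_powr (a * x) p"
proof -
  have "a $ i * x $ i powr p = a $ i powr (1 - p) * (a $ i * x $ i) powr p" for i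
  proof -
    have "0 < a $ i" "0 < x $ i"
      using assms by (auto simp: vec_pos_def)
    moreover from this have "a $ i powr (1 - p) * a $ i powr p = a $ i"
      by (simp flip: powr_add)
    ultimately show ?thesis
      by (simp add: powr_mult flip: mult.assoc)
  qed
  then show ?thesis
    by (simp add: vec_eq_iff vec_powr_def)
qed

text \<open>Links the two-sided diagonal scaling of the theorem to the entrywise form used
  throughout, which multiplies directly with the kernel \<open>X k * K\<close>.\<close>

lemma diag_mat_mult_mult_diag_mat: "diag_mat a ** A ** diag_mat b = outer_prod a b * A"
  by (simp add: vec_eq_iff matrix_matrix_mult_def diag_mat_def outer_prod_def
      if_distrib[of "\<lambda>x. x * _"] if_distrib[of "\<lambda>x. _ * x"] cong: if_cong)

text \<open>The row factor \<open>a\<close> leaves the sum over columns, while the column factor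
  \<open>b\<close> is absorbed into the vector.\<close>

lemma outer_prod_scaling_mult_vec: "(outer_prod a b * A) *v x = a * (A *v (b * x))"
  by (simp add: vec_eq_iff matrix_vector_mult_def outer_prod_def sum_distrib_left mult_ac)

lemma transpose_outer_prod_scaling:
  "transpose (outer_prod a b * A) = outer_prod b a * transpose A"
  by (simp add: vec_eq_iff transpose_def outer_prod_def mult_ac)

lemma mat_powr_zero: "mat_pos A \<Longrightarrow> mat_powr A 0 = 1"
  by (auto simp: vec_eq_iff mat_powr_def mat_pos_def) (metis less_irrefl)

lemma mat_powr_mult_self: "mat_pos A \<Longrightarrow> mat_powr A p * A = mat_powr A (p + 1)"
  by (simp add: vec_eq_iff mat_powr_def mat_pos_def powr_add less_imp_le)

lemma outer_prod_one: "outer_prod 1 1 = 1"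
  by (simp add: vec_eq_iff outer_prod_def)

text \<open>For positive entries \<open>powr\<close> distributes over
  \<open>K * outer_prod x y\<close>: the outer product updates the two scalings, and the exponents
  of \<open>K\<close> add up.\<close>

lemma scaling_update:
  assumes "mat_pos K" "vec_pos x" "vec_pos y"
  shows "outer_prod a b * mat_powr K q * mat_powr (K * outer_prod x y) p
    = outer_prod (a * vec_powr x p) (b * vec_powr y p) * mat_powr K (q + p)"
  using assms
  by (simp add: vec_eq_iff outer_prod_def mat_powr_def vec_powr_def mat_pos_def vec_pos_def
      powr_mult powr_add less_imp_le mult_ac)

text \<open>The case \<open>k = 0\<close> is included: the range \<open>{0..- 1}\<close> is empty
  and its product is 1.\<close>

lemma prod_int_atLeastAtMost_rec:
  fixes f :: "int \<Rightarrow> 'a :: comm_monoid_mult"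
  assumes "0 \<le> k"
  shows "(\<Prod>t\<in>{0..k}. f t) = (\<Prod>t\<in>{0..k - 1}. f t) * f k"
proof -
  have "{0..k} = insert k {0..k - 1}"
    using assms by auto
  then show ?thesis
    by (simp add: mult.commute)
qed

text \<open>One iteration from an arbitrary positively scaled state. It serves both to propagate the
  invariant and to read off the recursions.\<close>

lemma obdrs_step:
  assumes r: "vec_pos r" and c: "vec_pos c" and K: "mat_pos K"
    and it: "obdrs_iterates r c K lam u v X" and k: "0 \<le> k"
    and X: "X k = outer_prod a b * mat_powr K (lam * of_int k)"
    and a: "vec_pos a" and b: "vec_pos b" and v: "vec_pos (v (k - 1))"
  shows "a * u k = r \<oslash> (mat_powr K (lam * of_int k + 1) *v (b * v (k - 1)))"
    and "b * v k = c \<oslash> (transpose (mat_powr K (lam * of_int k + 1)) *v (a * u k))"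
    and "vec_pos (u k)" and "vec_pos (v k)"
    and "X (k + 1) = outer_prod (a * vec_powr (u k) lam) (b * vec_powr (v k) lam)
      * mat_powr K (lam * of_int (k + 1))"
proof -
  let ?K = "mat_powr K (lam * of_int k + 1)"
  have XK: "X k * K = outer_prod a b * ?K"
    by (simp add: X mult.assoc mat_powr_mult_self[OF K])
  have K': "mat_pos ?K" "mat_pos (transpose ?K)"
    by (simp_all add: mat_pos_powr mat_pos_transpose K)
  have u_eq: "u k = r \<oslash> (a * (?K *v (b * v (k - 1))))"
    using it k by (simp add: obdrs_iterates_def XK outer_prod_scaling_mult_vec)
  then show "a * u k = r \<oslash> (?K *v (b * v (k - 1)))"
    by (simp only: vec_divide_mult_cancel[OF a])
  show u: "vec_pos (u k)"
    unfolding u_eq by (intro vec_pos_divide vec_pos_mult vec_pos_matrix_vector_mult r a b v K')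
  \<comment> \<open>Transposition swaps the scalings, so \<open>b\<close> now comes out in front and
    \<open>a\<close> joins \<open>u k\<close>.\<close>
  have v_eq: "v k = c \<oslash> (b * (transpose ?K *v (a * u k)))"
    using it k unfolding obdrs_iterates_def
    by (simp only: XK outer_prod_scaling_mult_vec transpose_outer_prod_scaling)
  then show "b * v k = c \<oslash> (transpose ?K *v (a * u k))"
    by (simp only: vec_divide_mult_cancel[OF b])
  show v: "vec_pos (v k)"
    unfolding v_eq by (intro vec_pos_divide vec_pos_mult vec_pos_matrix_vector_mult c a b u K')
  have "X (k + 1) = X k * mat_powr (K * outer_prod (u k) (v k)) lam"
    using it k by (simp add: obdrs_iterates_def)
  then show "X (k + 1) = outer_prod (a * vec_powr (u k) lam) (b * vec_powr (v k) lam)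
      * mat_powr K (lam * of_int (k + 1))"
    by (simp add: X scaling_update K u v distrib_left)
qed

theorem proposition2:
  fixes r :: "real ^ 'm" and c :: "real ^ 'n"
    and C K :: "real ^ 'n ^ 'm" and \<eta> lam :: real
    and u \<alpha> :: "int \<Rightarrow> real ^ 'm" and v \<beta> :: "int \<Rightarrow> real ^ 'n"
    and X :: "int \<Rightarrow> real ^ 'n ^ 'm"
  assumes "\<forall>i. r $ i > 0" and "\<forall>j. c $ j > 0"
    and "(\<Sum>i\<in>UNIV. r $ i) = 1" and "(\<Sum>j\<in>UNIV. c $ j) = 1"
    and "\<eta> > 0" and "K = mat_exp_entrywise ((1 / \<eta>) *\<^sub>R (- C))"
    and "1 \<le> lam" and "lam < 2"
    and "obdrs_iterates r c K lam u v X"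
    and "\<forall>k\<ge>0. \<alpha> k = (\<Prod>t\<in>{0..k}. vec_powr (u t) lam)"
    and "\<forall>k\<ge>0. \<beta> k = (\<Prod>t\<in>{0..k}. vec_powr (v t) lam)"
    and "\<alpha> (- 1) = 1" and "\<beta> (- 1) = 1" and "\<beta> (- 2) = 1"
  shows "\<forall>k\<ge>0.
    (let K\<^sub>O = mat_powr K (lam * of_int k + 1);
         \<beta>t = \<beta> (k - 1) * vec_powr (\<beta> (k - 1) \<oslash> \<beta> (k - 2)) (1 / lam);
         \<alpha>h = r \<oslash> (K\<^sub>O *v \<beta>t);
         \<beta>h = c \<oslash> (transpose K\<^sub>O *v \<alpha>h)
     in \<alpha> k = vec_powr (\<alpha> (k - 1)) (1 - lam) * vec_powr \<alpha>h lam \<and>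
        \<beta> k = vec_powr (\<beta> (k - 1)) (1 - lam) * vec_powr \<beta>h lam \<and>
        X (k + 1) = diag_mat (\<alpha> k) ** mat_powr K (lam * of_int (k + 1)) ** diag_mat (\<beta> k))"
proof -
  have r: "vec_pos r" and c: "vec_pos c"
    using assms(1,2) by (simp_all add: vec_pos_def)
  have K: "mat_pos K"
    by (simp add: assms(6) mat_pos_exp_entrywise)
  note it = assms(9)
  \<comment> \<open>The prescribed value 1 at index -1 is the empty product, so the recursion
    already holds at \<open>k = 0\<close>.\<close>
  have \<alpha>_eq: "\<alpha> k = (\<Prod>t\<in>{0..k}. vec_powr (u t) lam)" if "-1 \<le> k" for k
    using that assms(10,12) by (cases "k = -1") auto
  have \<beta>_eq: "\<beta> k = (\<Prod>t\<in>{0..k}. vec_powr (v t) lam)" if "-1 \<le> k" for k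
    using that assms(11,13) by (cases "k = -1") auto
  have \<alpha>_rec: "\<alpha> k = \<alpha> (k - 1) * vec_powr (u k) lam" if "0 \<le> k" for k
    using that by (simp add: \<alpha>_eq prod_int_atLeastAtMost_rec)
  have \<beta>_rec: "\<beta> k = \<beta> (k - 1) * vec_powr (v k) lam" if "0 \<le> k" for k
    using that by (simp add: \<beta>_eq prod_int_atLeastAtMost_rec)
  \<comment> \<open>The last conjunct recovers \<open>v (k - 1)\<close> from the scalings alone,
    which is what identifies the extrapolated vector \<open>\<beta>t\<close> with
    \<open>\<beta> (k - 1) * v (k - 1)\<close>.\<close>
  have inv: "X k = outer_prod (\<alpha> (k - 1)) (\<beta> (k - 1)) * mat_powr K (lam * of_int k) \<and>
      vec_pos (\<alpha> (k - 1)) \<and> vec_pos (\<beta> (k - 1)) \<and> vec_pos (v (k - 1)) \<and>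
      vec_powr (\<beta> (k - 1) \<oslash> \<beta> (k - 2)) (1 / lam) = v (k - 1)" if "0 \<le> k" for k
    using that
  proof (induction k rule: int_ge_induct)
    case base
    then show ?case
      \<comment> \<open>At \<open>k = 0\<close> the quotient is
        \<open>\<beta> (- 1) \<oslash> \<beta> (- 2) = 1\<close>, matching
        \<open>v (- 1) = 1\<close>, and the all-ones state is the zeroth entrywise power of
        \<open>K\<close>.\<close>
      using it assms(12-14)
      by (simp add: obdrs_iterates_def vec_pos_one outer_prod_one mat_powr_zero K
          vec_divide_one vec_powr_one)
  next
    case (step k)
    have IH: "X k = outer_prod (\<alpha> (k - 1)) (\<beta> (k - 1)) * mat_powr K (lam * of_int k)"
      "vec_pos (\<alpha> (k - 1))" "vec_pos (\<beta> (k - 1))" "vec_pos (v (k - 1))"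
      using step.IH by blast+
    note S = obdrs_step[OF r c K it step.hyps IH]
    have "\<beta> k \<oslash> \<beta> (k - 1) = vec_powr (v k) lam"
      by (simp add: \<beta>_rec[OF step.hyps] vec_divide_mult_self IH(3))
    then have "vec_powr (\<beta> k \<oslash> \<beta> (k - 1)) (1 / lam) = v k"
      using assms(7) by (simp add: vec_powr_powr_inverse S(4))
    moreover have "vec_pos (\<alpha> k)" "vec_pos (\<beta> k)"
      by (simp_all add: \<alpha>_rec \<beta>_rec step.hyps vec_pos_mult vec_pos_powr IH S(3,4))
    moreover have "k + 1 - 2 = k - 1"
      by simp
    ultimately show ?case
      using S(4,5) by (simp add: \<alpha>_rec[OF step.hyps, symmetric] \<beta>_rec[OF step.hyps, symmetric])
  qed
  show ?thesis
  proof (intro allI impI)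
    fix k :: int
    assume k: "0 \<le> k"
    have X: "X k = outer_prod (\<alpha> (k - 1)) (\<beta> (k - 1)) * mat_powr K (lam * of_int k)"
      and a: "vec_pos (\<alpha> (k - 1))" and b: "vec_pos (\<beta> (k - 1))"
      and v: "vec_pos (v (k - 1))"
      and v_eq: "vec_powr (\<beta> (k - 1) \<oslash> \<beta> (k - 2)) (1 / lam) = v (k - 1)"
      using inv[OF k] by blast+
    note S = obdrs_step[OF r c K it k X a b v]
    have "\<alpha> k = vec_powr (\<alpha> (k - 1)) (1 - lam) * vec_powr (\<alpha> (k - 1) * u k) lam"
      by (simp only: \<alpha>_rec[OF k] vec_powr_relaxation[OF a S(3)])
    moreover have "\<beta> k = vec_powr (\<beta> (k - 1)) (1 - lam) * vec_powr (\<beta> (k - 1) * v k) lam"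
      by (simp only: \<beta>_rec[OF k] vec_powr_relaxation[OF b S(4)])
    moreover have "X (k + 1) = diag_mat (\<alpha> k) ** mat_powr K (lam * of_int (k + 1)) ** diag_mat (\<beta> k)"
      by (simp only: S(5) \<alpha>_rec[OF k] \<beta>_rec[OF k] diag_mat_mult_mult_diag_mat)
    ultimately show "let K\<^sub>O = mat_powr K (lam * of_int k + 1);
         \<beta>t = \<beta> (k - 1) * vec_powr (\<beta> (k - 1) \<oslash> \<beta> (k - 2)) (1 / lam);
         \<alpha>h = r \<oslash> (K\<^sub>O *v \<beta>t);
         \<beta>h = c \<oslash> (transpose K\<^sub>O *v \<alpha>h)
     in \<alpha> k = vec_powr (\<alpha> (k - 1)) (1 - lam) * vec_powr \<alpha>h lam \<and>
        \<beta> k = vec_powr (\<beta> (k - 1)) (1 - lam) * vec_powr \<beta>h lam \<and>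
        X (k + 1) = diag_mat (\<alpha> k) ** mat_powr K (lam * of_int (k + 1)) ** diag_mat (\<beta> k)"
      \<comment> \<open>After \<open>v_eq\<close>, the expression for \<open>\<alpha>h\<close> folds
        to \<open>\<alpha> (k - 1) * u k\<close>; only then does \<open>\<beta>h\<close>, which
        contains it, fold to \<open>\<beta> (k - 1) * v k\<close>.\<close>
      unfolding Let_def v_eq S(1,2)[symmetric] by blast
  qed
qed

end
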